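(* Let $m\geq 2$ be an integer and $H$ be a connected graph of order $n$. If $G=P_m\Box H$, then $p(G)\leq \frac{n(G)}{2}$, where $n(G)=mn$ is the order of $G$.
   Context: All graphs are finite, simple and undirected. $P_m$ is the path on $m$ vertices. A path decomposition of a graph $G$ is a collection of edge-disjoint paths covering all edges of $G$; $p(G)$ denotes the minimum number of paths in a path decomposition of $G$. The Cartesian product $G\Box H$ has vertex set $V(G)\times V(H)$, with $(u_1,v_1)(u_2,v_2)$ an edge iff either $u_1u_2\in E(G)$ and $v_1=v_2$, or $v_1v_2\in E(H)$ and $u_1=u_2$. *)

theory Defs
  imports Complex_Main "HOL-Library.Disjoint_Sets"
begin

datatype 'a graph = Graph (verts: "'a set") (edges: "'a set set")

definition simple_graph :: "'a graph \<Rightarrow> bool" where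
  "simple_graph G \<longleftrightarrow> finite (verts G) \<and> (\<forall>e\<in>edges G. e \<subseteq> verts G \<and> card e = 2)"

definition order :: "'a graph \<Rightarrow> nat" where
  "order G = card (verts G)"

definition subgraph :: "'a graph \<Rightarrow> 'a graph \<Rightarrow> bool" where
  "subgraph F G \<longleftrightarrow> verts F \<subseteq> verts G \<and> edges F \<subseteq> edges G"

definition path_on :: "'a list \<Rightarrow> 'a graph" where
  "path_on xs = Graph (set xs) {{xs ! i, xs ! Suc i} | i. Suc i < length xs}"

definition is_path :: "'a graph \<Rightarrow> bool" where
  "is_path Q \<longleftrightarrow> (\<exists>xs. xs \<noteq> [] \<and> distinct xs \<and> Q = path_on xs)"

definition path_graph :: "nat \<Rightarrow> nat graph" where
  "path_graph m = Graph {0..<m} {{i, Suc i} | i. Suc i < m}"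

definition connected_graph :: "'a graph \<Rightarrow> bool" where
  "connected_graph G \<longleftrightarrow> verts G \<noteq> {} \<and>
     (\<forall>u\<in>verts G. \<forall>v\<in>verts G. \<exists>xs. xs \<noteq> [] \<and> distinct xs \<and> subgraph (path_on xs) G
        \<and> hd xs = u \<and> last xs = v)"

definition cartesian_product :: "'a graph \<Rightarrow> 'b graph \<Rightarrow> ('a \<times> 'b) graph" (infixl "\<box>" 75) where
  "G \<box> H = Graph (verts G \<times> verts H)
     {{(u1, v1), (u2, v2)} | u1 v1 u2 v2.
        u1 \<in> verts G \<and> u2 \<in> verts G \<and> v1 \<in> verts H \<and> v2 \<in> verts H \<and>
        ({u1, u2} \<in> edges G \<and> v1 = v2 \<or> {v1, v2} \<in> edges H \<and> u1 = u2)}"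

text \<open>Single-vertex paths are allowed as members of a decomposition; dropping them never
  increases the number of paths, so the minimum below is unaffected.\<close>

definition path_decomposition :: "'a graph \<Rightarrow> 'a graph set \<Rightarrow> bool" where
  "path_decomposition G P \<longleftrightarrow> finite P \<and>
     (\<forall>Q\<in>P. is_path Q \<and> subgraph Q G) \<and>
     disjoint_family_on edges P \<and>
     (\<Union>Q\<in>P. edges Q) = edges G"

text \<open>For a simple graph the minimum is attained, since the single-edge paths always form
  a decomposition.\<close>

definition path_number :: "'a graph \<Rightarrow> nat" where
  "path_number G = (LEAST k. \<exists>P. path_decomposition G P \<and> card P = k)"

lemma path_number_attained:
  assumes "simple_graph G"
  shows "\<exists>P. path_decomposition G P \<and> card P = path_number G"
proof -
  let ?P = "(\<lambda>e. Graph e {e}) ` edges G"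
  have "edges G \<subseteq> Pow (verts G)" and fin: "finite (verts G)"
    using assms by (auto simp: simple_graph_def)
  then have "finite (edges G)"
    by (meson finite_Pow_iff finite_subset)
  moreover have "is_path (Graph e {e}) \<and> subgraph (Graph e {e}) G" if e: "e \<in> edges G" for e
  proof -
    obtain u v where uv: "e = {u, v}" "u \<noteq> v"
      using assms e by (auto simp: simple_graph_def card_2_iff)
    have "{{[u, v] ! i, [u, v] ! Suc i} | i. Suc i < length [u, v]} = {e}"
      using uv by auto
    then have "Graph e {e} = path_on [u, v]"
      using uv by (simp add: path_on_def)
    moreover have "distinct [u, v]" using uv by simp
    ultimately have "is_path (Graph e {e})"
      unfolding is_path_def by blast
    then show ?thesis
      using assms e by (auto simp: subgraph_def simple_graph_def)
  qed
  ultimately have "path_decomposition G ?P"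
    by (auto simp: path_decomposition_def disjoint_family_on_def)
  then have "\<exists>k P. path_decomposition G P \<and> card P = k" by blast
  then show ?thesis
    unfolding path_number_def by (rule LeastI_ex)
qed

end

theory Submission
  imports Defs "HOL-Library.Multiset"
begin

text \<open>By a path-shifting argument in the style of Lovasz, the edges of any graph \<open>H\<close> split into
  paths, trivial ones allowed, such that every odd vertex is exactly once an end of a path and
  every even vertex exactly twice. The paths can be oriented so that no vertex is twice a first or
  twice a last vertex, so each vertex of even degree is the last vertex of one path and the first
  of another. Copy these \<open>c\<close> paths into each of the \<open>m\<close> layers and join the last vertex of a path
  in one layer, by the vertical edge above it, to the path starting at the next copy of that
  vertex. The vertical edges at odd vertices prolong free ends. This leaves
  \<open>c + (m - 1) (n - c)\<close> paths, which is at most \<open>m n / 2\<close> since \<open>n \<le> 2 c\<close> and \<open>m \<ge> 2\<close>.\<close>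

section \<open>Paths as vertex lists, with multisets of edges and of ends\<close>

fun path_edges :: "'a list \<Rightarrow> 'a set multiset" where
  "path_edges (x # y # xs) = add_mset {x, y} (path_edges (y # xs))"
| "path_edges _ = {#}"

text \<open>The trivial path \<open>[v]\<close> counts \<open>v\<close> twice. This lets an isolated
  even vertex obtain its two ends from one trivial path.\<close>

definition path_ends :: "'a list \<Rightarrow> 'a multiset" where
  "path_ends p = {#hd p, last p#}"

text \<open>Multisets let one equation with \<open>mset_set E\<close> say both that every edge is
  covered and that no edge is used twice.\<close>

definition family_edges :: "'a list list \<Rightarrow> 'a set multiset" where
  "family_edges F = sum_list (map path_edges F)"

definition family_ends :: "'a list list \<Rightarrow> 'a multiset" where
  "family_ends F = sum_list (map path_ends F)"

lemma family_simps [simp]: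
  "family_edges [] = {#}" "family_edges (p # F) = path_edges p + family_edges F"
  "family_edges (A @ B) = family_edges A + family_edges B"
  "family_ends [] = {#}" "family_ends (p # F) = path_ends p + family_ends F"
  "family_ends (A @ B) = family_ends A + family_ends B"
  by (simp_all add: family_edges_def family_ends_def)

lemma path_edges_append:
  "p \<noteq> [] \<Longrightarrow> q \<noteq> [] \<Longrightarrow>
    path_edges (p @ q) = path_edges p + {#{last p, hd q}#} + path_edges q"
  by (induction p rule: path_edges.induct) (cases q; auto)+

lemma path_edges_rev [simp]: "path_edges (rev p) = path_edges p"
proof (induction p rule: path_edges.induct)
  case (1 x y xs)
  have "path_edges (rev (x # y # xs)) = path_edges (rev (y # xs) @ [x])" by simp
  also have "\<dots> = path_edges (rev (y # xs)) + {#{y, x}#}"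
    by (subst path_edges_append) auto
  finally show ?case using 1 by (simp add: insert_commute)
qed auto

lemma path_ends_rev [simp]: "p \<noteq> [] \<Longrightarrow> path_ends (rev p) = path_ends p"
  by (simp add: path_ends_def hd_rev last_rev add_mset_commute)

lemma path_edges_map: "path_edges (map f p) = image_mset ((`) f) (path_edges p)"
  by (induction p rule: path_edges.induct) auto

lemma path_edges_conv_nth:
  "set_mset (path_edges p) = {{p ! i, p ! Suc i} | i. Suc i < length p}"
proof (induction p rule: path_edges.induct)
  case (1 x y xs)
  show ?case
  proof (rule set_eqI)
    fix e
    have "(\<exists>i. e = {(x # y # xs) ! i, (x # y # xs) ! Suc i} \<and> Suc i < length (x # y # xs)) \<longleftrightarrow>
      e = {x, y} \<or> (\<exists>i. e = {(y # xs) ! i, (y # xs) ! Suc i} \<and> Suc i < length (y # xs))"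
      (is "(\<exists>i. ?P i) \<longleftrightarrow> _")
    proof -
      have "(\<exists>i. ?P i) \<longleftrightarrow> ?P 0 \<or> (\<exists>i. ?P (Suc i))"
        by (metis not0_implies_Suc)
      then show ?thesis by simp
    qed
    then show "e \<in># path_edges (x # y # xs) \<longleftrightarrow>
        e \<in> {{(x # y # xs) ! i, (x # y # xs) ! Suc i} | i. Suc i < length (x # y # xs)}"
      using 1 by auto
  qed
qed auto

text \<open>Controls where the vertices of a path lie: each is the single vertex of a trivial path,
  hence an end, or is on an edge of the path.\<close>

lemma path_edge_cases:
  assumes "v \<in> set p"
  shows "p = [v] \<or> (\<exists>e\<in>#path_edges p. v \<in> e)"
  using assms by (induction p rule: path_edges.induct) auto

lemma path_edges_subset: "e \<in># path_edges p \<Longrightarrow> e \<subseteq> set p"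
  by (induction p rule: path_edges.induct) auto

lemma in_family_ends: "v \<in># family_ends F \<longleftrightarrow> (\<exists>p\<in>set F. v \<in># path_ends p)"
  by (induction F) auto

lemma in_family_edges: "e \<in># family_edges F \<longleftrightarrow> (\<exists>p\<in>set F. e \<in># path_edges p)"
  by (induction F) auto

section \<open>Path shifting\<close>

text \<open>Both later conditions serve the gluing: the cut-off half starts at \<open>a\<close>, so
  its replacement must start there too, and the bound on the vertex set keeps it disjoint from the
  reversed half.\<close>

definition shifted :: "'a \<Rightarrow> 'a list \<Rightarrow> 'a list \<Rightarrow> bool" where
  "shifted a p q \<longleftrightarrow> q \<noteq> [] \<and> distinct q \<and> set q \<subseteq> insert a (set p) \<and> (hd p = a \<longrightarrow> hd q = a)"

lemma shifted_refl: "\<forall>p\<in>set F. p \<noteq> [] \<and> distinct p \<Longrightarrow> list_all2 (shifted a) F F"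
  by (induction F) (auto simp: shifted_def)

text \<open>Take a path \<open>y \<dots> w a \<dots>\<close> ending at \<open>y\<close>: trading the edge \<open>wa\<close> for \<open>ya\<close> turns it into
  \<open>w \<dots> y a \<dots>\<close>, and \<open>wa\<close> is the next edge to insert. The reversed half is never touched again, so it
  can be cut off before the induction hypothesis is applied and glued back to the path that
  has taken the place of the other half; \<open>shifted\<close> tracks that path.\<close>

lemma path_shift:
  assumes "\<forall>p\<in>set F. p \<noteq> [] \<and> distinct p"
    and "y \<in># family_ends F" and "y \<noteq> a"
    and "\<And>w. {w, a} \<in># family_edges F \<Longrightarrow> w \<in># family_ends F"
    and "\<And>w. count (add_mset {y, a} (family_edges F)) {w, a} \<le> 1"
  shows "\<exists>F'. list_all2 (shifted a) F F' \<and> family_edges F' = add_mset {y, a} (family_edges F)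
     \<and> add_mset y (family_ends F') = add_mset a (family_ends F)"
  using assms
proof (induction "size (family_edges F)" arbitrary: F y rule: less_induct)
  case less
  obtain p where p: "p \<in> set F" "y \<in># path_ends p"
    using less.prems(2) by (auto simp: in_family_ends)
  obtain A B where F: "F = A @ p # B" using p(1) by (meson split_list)
  have pd: "p \<noteq> []" "distinct p" using p less.prems(1) by auto
  have "hd p = y \<or> hd (rev p) = y" using p(2) by (auto simp: path_ends_def hd_rev)
  then obtain q where q: "q = p \<or> q = rev p" "hd q = y" by blast
  have q': "q \<noteq> []" "distinct q" "set q = set p" "path_edges q = path_edges p"
    "path_ends q = path_ends p"
    using q pd by auto
  have ends_p: "path_ends p = {#y, last q#}" using q(2) q'(5) by (simp add: path_ends_def)
  have AB: "list_all2 (shifted a) A A" "list_all2 (shifted a) B B"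
    using less.prems(1) F by (auto intro!: shifted_refl)
  have ya: "{y, a} \<notin># family_edges F"
    using less.prems(5)[of y] by (auto simp: not_in_iff)
  show ?case
  proof (cases "a \<in> set p")
    case False
    \<comment> \<open>If \<open>a\<close> is off the path, the path is just prolonged from
      \<open>y\<close> to \<open>a\<close>.\<close>
    let ?F = "A @ (a # q) # B"
    have "shifted a p (a # q)"
      using False q' pd by (auto simp: shifted_def)
    then have "list_all2 (shifted a) F ?F"
      using AB F by (auto intro: list_all2_appendI)
    moreover have "path_edges (a # q) = add_mset {y, a} (path_edges p)"
      using q q' by (cases q) (auto simp: insert_commute)
    then have "family_edges ?F = add_mset {y, a} (family_edges F)"
      using F by simp
    moreover have "add_mset y (path_ends (a # q)) = add_mset a (path_ends p)"
      using q' unfolding ends_p by (simp add: path_ends_def)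
    then have "add_mset y (family_ends ?F) = add_mset a (family_ends F)"
      using F by simp
    ultimately show ?thesis by blast
  next
    case True
    then obtain P1 P2 where P: "q = P1 @ a # P2" using q' by (metis split_list)
    have P1: "P1 \<noteq> []" using P q less.prems(3) by auto
    have hP1: "hd P1 = y" using P q P1 by auto
    define w where "w = last P1"
    define G where "G = A @ (a # P2) # B"
    have edges_p: "path_edges p = path_edges P1 + {#{w, a}#} + path_edges (a # P2)"
      using path_edges_append[of P1 "a # P2"] P P1 q' by (simp add: w_def)
    have edges_F: "family_edges F = add_mset {w, a} (path_edges P1 + family_edges G)"
      unfolding F G_def by (simp add: edges_p)
    have "add_mset a (path_ends p) = add_mset y (path_ends (a # P2))"
      using P unfolding ends_p by (simp add: path_ends_def)
    then have ends_F: "add_mset a (family_ends F) = add_mset y (family_ends G)"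
      unfolding F G_def by simp
    \<comment> \<open>The cut costs only \<open>y\<close> an end. The neighbour \<open>w\<close> of
      \<open>a\<close> had one by hypothesis and keeps it, since \<open>w = y\<close> would make
      \<open>{y, a}\<close> an old edge.\<close>
    have wy: "w \<noteq> y" using ya edges_F by auto
    have wa: "w \<noteq> a" using q' P P1 unfolding w_def by (metis Int_iff distinct_append
          empty_iff last_in_set list.set_intros(1))
    have ends_G: "z \<in># family_ends G" if "z \<in># family_ends F" "z \<noteq> y" for z
      using that ends_F by (metis insert_iff set_mset_add_mset_insert)
    have "\<exists>F'. list_all2 (shifted a) G F' \<and> family_edges F' = add_mset {w, a} (family_edges G)
     \<and> add_mset w (family_ends F') = add_mset a (family_ends G)"
    proof (rule less.hyps)
      show "size (family_edges G) < size (family_edges F)" using edges_F by simp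
      show "\<forall>p\<in>set G. p \<noteq> [] \<and> distinct p"
        using less.prems(1) q' P unfolding G_def F by auto
      show "w \<in># family_ends G" using ends_G wy less.prems(4) edges_F by simp
      show "w \<noteq> a" by fact
    next
      fix z assume "{z, a} \<in># family_edges G"
      then have "{z, a} \<in># family_edges F" using edges_F by simp
      then show "z \<in># family_ends G" using less.prems(4) ends_G ya by metis
    next
      fix z
      have "count (add_mset {w, a} (family_edges G)) {z, a} \<le> count (family_edges F) {z, a}"
        using edges_F by simp
      also have "\<dots> \<le> 1" using less.prems(5)[of z] by (auto split: if_splits)
      finally show "count (add_mset {w, a} (family_edges G)) {z, a} \<le> 1" .
    qed
    then obtain G' where G': "list_all2 (shifted a) G G'"
      "family_edges G' = add_mset {w, a} (family_edges G)"
      "add_mset w (family_ends G') = add_mset a (family_ends G)" by blast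
    obtain A' r B' where r: "G' = A' @ r # B'" "list_all2 (shifted a) A A'"
      "shifted a (a # P2) r" "list_all2 (shifted a) B B'"
      using G'(1) unfolding G_def by (auto simp: list_all2_append1 list_all2_Cons1)
    have r': "r \<noteq> []" "distinct r" "hd r = a" "set r \<subseteq> insert a (set P2)"
      using r(3) by (auto simp: shifted_def)
    define p1 where "p1 = rev P1 @ r"
    have p1: "p1 \<noteq> []" "distinct p1" "set p1 \<subseteq> set p"
      using q' P P1 r' unfolding p1_def by (auto simp flip: q'(3))
    have p1_edges: "path_edges p1 = path_edges P1 + {#{y, a}#} + path_edges r"
      using P1 r' hP1 unfolding p1_def by (simp add: path_edges_append last_rev)
    have p1_ends: "add_mset a (path_ends p1) = add_mset w (path_ends r)"
      using P1 r' unfolding p1_def by (simp add: path_ends_def hd_rev w_def)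
    \<comment> \<open>\<open>shifted\<close> demands that a path starting at \<open>a\<close> still
      starts there. In that case \<open>q\<close> ends at \<open>a\<close>, so \<open>P2\<close> is
      empty, \<open>r\<close> has \<open>a\<close> as its only vertex and \<open>p1\<close> ends at
      \<open>a\<close>; reversing it repairs the first vertex.\<close>
    define p' where "p' = (if hd p = a then rev p1 else p1)"
    have "hd p' = a" if "hd p = a"
    proof -
      have "q = rev p" using q that less.prems(3) by auto
      then have "last q = a" using that pd by (simp add: last_rev)
      then have "P2 = []" using P q'(2) by (cases P2 rule: rev_cases) auto
      then have "set r \<subseteq> {a}" using r' by auto
      then have "last r = a" using r'(1) by (meson last_in_set singletonD subsetD)
      then show ?thesis using that r' by (simp add: p'_def p1_def hd_rev)
    qed
    then have "shifted a p p'"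
      using p1 by (auto simp: shifted_def p'_def)
    moreover have p': "path_edges p' = path_edges p1" "path_ends p' = path_ends p1"
      using p1 by (auto simp: p'_def)
    moreover have "list_all2 (shifted a) F (A' @ p' # B')"
      using r F calculation by (auto intro!: list_all2_appendI)
    moreover have "family_edges (A' @ p' # B') = add_mset {y, a} (family_edges F)"
      using G'(2) unfolding r(1) edges_F by (simp add: p' p1_edges)
    \<comment> \<open>Gluing trades the end \<open>a\<close> of \<open>r\<close> for
      \<open>w\<close>, which cancels the trade of \<open>w\<close> for \<open>a\<close> made by the
      induction hypothesis.\<close>
    moreover have "add_mset a (family_ends (A' @ p' # B')) = add_mset w (family_ends G')"
      using r(1) p1_ends p' by simp
    then have "family_ends (A' @ p' # B') = family_ends G"
      using G'(3) by simp
    ultimately show ?thesis using ends_F by metis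
  qed
qed

definition decomposes :: "'a list list \<Rightarrow> 'a set multiset \<Rightarrow> 'a multiset \<Rightarrow> bool" where
  "decomposes F M D \<longleftrightarrow> (\<forall>p\<in>set F. p \<noteq> [] \<and> distinct p) \<and> family_edges F = M \<and> family_ends F = D"

text \<open>Edges in a set have no multiplicities, so the last hypothesis of
  \<open>path_shift\<close> holds automatically for a new edge. The new edge moves one end from
  \<open>y\<close> to \<open>a\<close>.\<close>

lemma shift_end:
  assumes F: "decomposes F (mset_set E) D" and "finite E"
    and new: "y \<noteq> a" "{y, a} \<notin> E" "y \<in># D" and nbrs: "\<And>w. {w, a} \<in> E \<Longrightarrow> w \<in># D"
  shows "\<exists>F'. decomposes F' (mset_set (insert {y, a} E)) (add_mset a (D - {#y#}))"
proof -
  have *: "add_mset {y, a} (family_edges F) = mset_set (insert {y, a} E)"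
    using assms by (simp add: decomposes_def)
  obtain F' where F': "list_all2 (shifted a) F F'"
    "family_edges F' = mset_set (insert {y, a} E)"
    "add_mset y (family_ends F') = add_mset a (family_ends F)"
  proof -
    have "count (add_mset {y, a} (family_edges F)) {w, a} \<le> 1" for w
      unfolding * by (simp add: count_mset_set')
    then show ?thesis
      using path_shift[of F y a] F new nbrs \<open>finite E\<close> that unfolding *
      by (auto simp: decomposes_def)
  qed
  have "\<forall>q\<in>set F'. q \<noteq> [] \<and> distinct q"
    using F'(1) by (auto simp: shifted_def list_all2_conv_all_nth in_set_conv_nth)
  moreover have "family_ends F' = add_mset a (D - {#y#})"
    using F'(3) F new by (metis add_mset_remove_trivial decomposes_def diff_union_swap)
  ultimately show ?thesis using F'(2) by (auto simp: decomposes_def)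
qed

section \<open>Degrees in simple graphs, and contraction of a subdivision vertex\<close>

definition degree :: "'a set set \<Rightarrow> 'a \<Rightarrow> nat" where
  "degree E v = card {e \<in> E. v \<in> e}"

lemma degree_insert:
  assumes "finite E" "e \<notin> E"
  shows "degree (insert e E) v = degree E v + of_bool (v \<in> e)"
proof -
  have "{f \<in> insert e E. v \<in> f} = (if v \<in> e then insert e {f \<in> E. v \<in> f} else {f \<in> E. v \<in> f})"
    by auto
  then show ?thesis using assms by (simp add: degree_def)
qed

lemma degree_remove:
  assumes "finite E" "e \<in> E"
  shows "degree E v = degree (E - {e}) v + of_bool (v \<in> e)"
  using degree_insert[of "E - {e}" e v] assms by (simp add: insert_absorb)

lemma simple_graph_finite_edges: "simple_graph (Graph V E) \<Longrightarrow> finite E"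
  unfolding simple_graph_def by (auto intro: finite_subset[of E "Pow V"])

lemma simple_graph_insert:
  "simple_graph (Graph V E) \<Longrightarrow> u \<in> V \<Longrightarrow> v \<in> V \<Longrightarrow> u \<noteq> v
    \<Longrightarrow> simple_graph (Graph V (insert {u, v} E))"
  by (auto simp: simple_graph_def)

lemma simple_graph_remove:
  "simple_graph (Graph V E) \<Longrightarrow> simple_graph (Graph V (E - X))"
  by (auto simp: simple_graph_def)

lemma simple_graph_edge:
  assumes "simple_graph (Graph V E)" "e \<in> E"
  obtains u v where "e = {u, v}" "u \<noteq> v" "u \<in> V" "v \<in> V"
proof -
  have "card e = 2" "e \<subseteq> V" using assms by (auto simp: simple_graph_def)
  then show ?thesis using that by (auto simp: card_2_iff)
qed

lemma simple_graph_edgeD: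
  assumes "simple_graph (Graph V E)" "{u, v} \<in> E"
  shows "u \<noteq> v" "u \<in> V" "v \<in> V"
  using assms by (auto simp: simple_graph_def)

lemma simple_graph_degree_pos:
  assumes "simple_graph (Graph V E)" "degree E v > 0"
  obtains a where "{v, a} \<in> E"
proof -
  obtain e where e: "e \<in> E" "v \<in> e"
    using assms(2) unfolding degree_def by (auto simp: card_gt_0_iff)
  then obtain a b where "e = {a, b}" using simple_graph_edge assms(1) by metis
  then show ?thesis using that e by (auto simp: insert_commute)
qed

text \<open>No path ends at \<open>x\<close>, so the path entering by \<open>xy\<close> also leaves
  \<open>x\<close>, and \<open>xu\<close> is the only other edge there. As a path repeats no vertex,
  the neighbours of \<open>x\<close> on it are \<open>y\<close> and \<open>u\<close> in some order;
  skipping \<open>x\<close> yields the edge \<open>uy\<close> with the same ends.\<close>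

lemma contract_vertex:
  assumes F: "decomposes F (M + {#{x, y}, {x, u}#}) D"
    and x: "x \<notin># D" "x \<notin> \<Union>(set_mset M)" and ne: "x \<noteq> y" "x \<noteq> u" "u \<noteq> y"
  shows "\<exists>F'. decomposes F' (add_mset {u, y} M) D"
proof -
  have "{x, y} \<in># family_edges F" using F by (simp add: decomposes_def)
  then obtain p where p: "p \<in> set F" "{x, y} \<in># path_edges p" by (auto simp: in_family_edges)
  obtain A B where FAB: "F = A @ p # B" using p(1) by (meson split_list)
  have pd: "p \<noteq> []" "distinct p" using p F by (auto simp: decomposes_def)
  have "x \<in> set p" using p path_edges_subset by fastforce
  then obtain P Q where PQ: "p = P @ x # Q" by (metis split_list)
  have xend: "x \<notin># path_ends p" using x F p by (auto simp: decomposes_def in_family_ends)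
  then have ne': "P \<noteq> []" "Q \<noteq> []" using PQ by (auto simp: path_ends_def)
  have "path_edges (x # Q) = add_mset {x, hd Q} (path_edges Q)"
    using ne' by (cases Q) auto
  then have pe: "path_edges p = path_edges P + {#{last P, x}, {x, hd Q}#} + path_edges Q"
    using path_edges_append[of P "x # Q"] PQ ne' by simp
  have xM: "e \<in> {{x, y}, {x, u}}" if "e \<in># path_edges p" "x \<in> e" for e
  proof -
    have "e \<in># family_edges F" using that p by (auto simp: in_family_edges)
    then show ?thesis using F that x by (auto simp: decomposes_def)
  qed
  have "{last P, x} \<in> {{x, y}, {x, u}}" "{x, hd Q} \<in> {{x, y}, {x, u}}"
    using xM pe by simp_all
  then have "last P \<in> {y, u}" "hd Q \<in> {y, u}"
    using ne by (auto simp: doubleton_eq_iff)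
  moreover have "last P \<in> set P" "hd Q \<in> set Q" using ne' by auto
  then have "last P \<noteq> hd Q" using pd PQ by auto
  ultimately have pair: "last P = y \<and> hd Q = u \<or> last P = u \<and> hd Q = y" by auto
  then have pe': "path_edges p = path_edges P + {#{x, y}, {x, u}#} + path_edges Q"
    unfolding pe by (auto simp: insert_commute)
  have pe'': "path_edges (P @ Q) = path_edges P + {#{u, y}#} + path_edges Q"
    using ne' pair by (auto simp: path_edges_append insert_commute)
  have "path_ends (P @ Q) = path_ends p"
    using ne' PQ by (simp add: path_ends_def)
  moreover have edges': "family_edges (A @ (P @ Q) # B) = add_mset {u, y} M"
  proof -
    have "family_edges F = M + {#{x, y}, {x, u}#}" using F by (simp add: decomposes_def)
    then show ?thesis unfolding FAB by (simp add: pe' pe'')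
  qed
  ultimately have "decomposes (A @ (P @ Q) # B) (add_mset {u, y} M) D"
    using F pd PQ ne' edges' unfolding decomposes_def FAB by auto
  then show ?thesis by blast
qed

section \<open>Decompositions with prescribed ends\<close>

text \<open>The vertex \<open>x\<close> is a token. If it is not isolated, deleting an edge \<open>xa\<close> moves the token
  to \<open>a\<close>, and the lemma \<open>shift_end\<close> puts the edge back. If it is isolated, it serves as a subdivision
  vertex of some edge, which makes its degree positive, and is contracted afterwards.\<close>

lemma odd_graph_decomposition:
  assumes "simple_graph (Graph V E)" "x \<in> V"
    and "\<And>v. v \<in> V \<Longrightarrow> even (degree E v) \<longleftrightarrow> v = x"
  shows "\<exists>F. decomposes F (mset_set E) (mset_set (V - {x}))"
  using assms
proof (induction "card E" arbitrary: V E x rule: less_induct)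
  case less
  have sg: "simple_graph (Graph V E)" and fin: "finite V" "finite E"
    using less.prems(1) simple_graph_finite_edges by (auto simp: simple_graph_def)
  \<comment> \<open>Stated for any \<open>E'\<close> with at most as many edges as \<open>E\<close>,
    since it is applied both to \<open>E\<close> with token \<open>x\<close> and to the subdivided
    graph \<open>E1\<close> with token \<open>u\<close>.\<close>
  have move: "\<exists>F. decomposes F (mset_set E') (mset_set (V - {z}))"
    if sg': "simple_graph (Graph V E')" and le: "card E' \<le> card E" and zaE: "{z, a} \<in> E'"
      and par: "\<And>v. v \<in> V \<Longrightarrow> even (degree E' v) \<longleftrightarrow> v = z" for E' z a
  proof -
    note za = simple_graph_edgeD[OF sg' zaE]
    have fE: "finite E'" using sg' simple_graph_finite_edges by auto
    \<comment> \<open>Deleting \<open>za\<close> flips the parities of \<open>z\<close> and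
      \<open>a\<close> only, so \<open>a\<close> becomes the unique even vertex.\<close>
    have "\<exists>F. decomposes F (mset_set (E' - {{z, a}})) (mset_set (V - {a}))"
    proof (rule less.hyps)
      show "card (E' - {{z, a}}) < card E"
        using fE le zaE by (metis card_Diff1_less less_le_trans)
      show "even (degree (E' - {{z, a}}) v) \<longleftrightarrow> v = a" if v: "v \<in> V" for v
        using degree_remove[OF fE zaE, of v] par[OF v] za
        by (auto split: if_splits)
    qed (use sg' za simple_graph_remove in auto)
    then obtain F where F: "decomposes F (mset_set (E' - {{z, a}})) (mset_set (V - {a}))" by blast
    have "\<exists>F. decomposes F (mset_set (insert {z, a} (E' - {{z, a}})))
        (add_mset a (mset_set (V - {a}) - {#z#}))"
    proof (rule shift_end[OF F])
      show "w \<in># mset_set (V - {a})" if "{w, a} \<in> E' - {{z, a}}" for w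
        using that fin simple_graph_edgeD[OF sg', of w a] by auto
    qed (use fE fin za in auto)
    moreover have "mset_set (V - {z}) = mset_set (insert a (V - {a} - {z}))"
      using za by (intro arg_cong[of _ _ mset_set]) auto
    then have "add_mset a (mset_set (V - {a}) - {#z#}) = mset_set (V - {z})"
      using za fin by (simp add: mset_set_Diff)
    ultimately show ?thesis using zaE by (simp add: insert_absorb)
  qed
  show ?case
  proof (cases "degree E x = 0")
    case False
    then obtain a where "{x, a} \<in> E" using simple_graph_degree_pos[OF sg] by blast
    then show ?thesis by (rule move[OF sg order_refl _ less.prems(3)])
  next
    case True
    then have xE: "x \<notin> e" if "e \<in> E" for e
      using that fin unfolding degree_def by auto
    show ?thesis
    proof (cases "E = {}")
      case True
      \<comment> \<open>Without edges all degrees are 0, hence even.\<close>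
      have "v = x" if "v \<in> V" for v
        using less.prems(3)[OF that] True by (simp add: degree_def)
      then have "V = {x}" using less.prems(2) by blast
      then have "decomposes [] (mset_set E) (mset_set (V - {x}))"
        using True by (simp add: decomposes_def)
      then show ?thesis by blast
    next
      case False
      then obtain e where e: "e \<in> E" by blast
      then obtain u y where uy: "e = {u, y}" "u \<noteq> y" "u \<in> V" "y \<in> V"
        using simple_graph_edge[OF sg] by metis
      have uyx: "u \<noteq> x" "y \<noteq> x" using xE e uy by auto
      show ?thesis
      \<comment> \<open>The subdivision will pass the token to \<open>u\<close>, which then needs an
        edge other than \<open>uy\<close>. If neither end of \<open>e\<close> has one,
        \<open>e\<close> is a component and becomes a path by itself; its vertices leave with it, as
        they would turn even.\<close>
      proof (cases "degree E u = 1 \<and> degree E y = 1")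
        case True
        then have d0: "degree (E - {e}) u = 0" "degree (E - {e}) y = 0"
          using degree_remove[OF fin(2) e] uy by force+
        then have uE: "u \<notin> f \<and> y \<notin> f" if "f \<in> E - {e}" for f
          using that fin by (auto simp: degree_def)
        have "\<exists>F. decomposes F (mset_set (E - {e})) (mset_set (V - {u, y} - {x}))"
        proof (rule less.hyps)
          show "card (E - {e}) < card E" using fin e by (meson card_Diff1_less)
          show "simple_graph (Graph (V - {u, y}) (E - {e}))"
            using sg uE by (fastforce simp: simple_graph_def)
          show "even (degree (E - {e}) v) \<longleftrightarrow> v = x" if "v \<in> V - {u, y}" for v
            using degree_remove[OF fin(2) e, of v] less.prems(3)[of v] that uy by auto
        qed (use less.prems uyx in auto)
        then obtain F where F: "decomposes F (mset_set (E - {e})) (mset_set (V - {u, y} - {x}))"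
          by blast
        have "mset_set E = add_mset e (mset_set (E - {e}))"
          using e fin by (simp add: mset_set.remove)
        moreover have "mset_set (V - {x}) = mset_set (insert u (insert y (V - {u, y} - {x})))"
          using uy uyx by (intro arg_cong[of _ _ mset_set]) auto
        ultimately have "decomposes ([u, y] # F) (mset_set E) (mset_set (V - {x}))"
          using F fin uy by (simp add: decomposes_def path_ends_def)
        then show ?thesis by blast
      next
        case False
        have "\<exists>u y. e = {u, y} \<and> degree E u \<noteq> 1"
          using False uy(1) by (metis insert_commute)
        then obtain u y where uy': "{u, y} \<in> E" "degree E u \<noteq> 1" using e by blast
        note uy = simple_graph_edgeD[OF sg uy'(1)]
        have uyx: "u \<noteq> x" "y \<noteq> x" using xE uy'(1) by auto
        \<comment> \<open>\<open>E1\<close> is \<open>E\<close> with \<open>uy\<close> subdivided by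
          \<open>x\<close> and the half \<open>xu\<close> still missing. Now \<open>x\<close> has
          degree 1, \<open>y\<close> is unchanged and \<open>u\<close> is the only even
          vertex.\<close>
        define E0 where "E0 = E - {{u, y}}"
        define E1 where "E1 = insert {x, y} E0"
        have xE0: "{x, z} \<notin> E0" for z using xE unfolding E0_def by auto
        have fE: "finite E0" "finite E1" using fin by (auto simp: E0_def E1_def)
        have deg0: "degree E v = degree E0 v + of_bool (v = u \<or> v = y)" for v
          using degree_remove[OF fin(2) uy'(1), of v] by (simp add: E0_def)
        have deg1: "degree E1 v = degree E0 v + of_bool (v = x \<or> v = y)" for v
          using degree_insert[OF fE(1) xE0, of y v] by (simp add: E1_def)
        have par: "even (degree E1 v) \<longleftrightarrow> v = u" if "v \<in> V" for v
          using deg0[of v] deg1[of v] less.prems(3)[OF that] uyx uy by (auto split: if_splits)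
        have "degree E u \<noteq> 0" using uy'(1) fin by (auto simp: degree_def)
        then have "degree E1 u > 0" using uy'(2) deg0[of u] deg1[of u] uyx uy by auto
        moreover have sg1: "simple_graph (Graph V E1)"
          unfolding E1_def E0_def using sg uy uyx less.prems(2)
          by (intro simple_graph_insert simple_graph_remove) auto
        ultimately obtain a where a: "{u, a} \<in> E1" using simple_graph_degree_pos by metis
        have "card E > 0" using fin uy'(1) by (auto simp: card_gt_0_iff)
        then have "card E1 \<le> card E"
          using uy'(1) xE0 fE unfolding E1_def E0_def by simp
        from move[OF sg1 this a par] obtain F where
          F: "decomposes F (mset_set E1) (mset_set (V - {u}))" by blast
        \<comment> \<open>Inserting \<open>xu\<close> moves the end at \<open>x\<close> to
          \<open>u\<close>, so no path ends at \<open>x\<close> any more, as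
          \<open>contract_vertex\<close> requires.\<close>
        have "\<exists>F. decomposes F (mset_set (insert {x, u} E1))
            (add_mset u (mset_set (V - {u}) - {#x#}))"
        proof (rule shift_end[OF F])
          show "{x, u} \<notin> E1" using xE0 uy unfolding E1_def by (auto simp: doubleton_eq_iff)
          show "w \<in># mset_set (V - {u})" if "{w, u} \<in> E1" for w
            using that fin simple_graph_edgeD[OF sg1, of w u] by auto
        qed (use fE fin less.prems(2) uyx in auto)
        moreover have "mset_set (insert {x, u} E1) = mset_set E0 + {#{x, y}, {x, u}#}"
          using fE xE0 uy uyx unfolding E1_def by (auto simp: doubleton_eq_iff)
        moreover have "mset_set (V - {x}) = mset_set (insert u (V - {u} - {x}))"
          using uy uyx by (intro arg_cong[of _ _ mset_set]) auto
        then have "add_mset u (mset_set (V - {u}) - {#x#}) = mset_set (V - {x})"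
          using less.prems(2) uyx fin by (simp add: mset_set_Diff)
        ultimately have "\<exists>F. decomposes F (mset_set E0 + {#{x, y}, {x, u}#}) (mset_set (V - {x}))"
          by simp
        then have "\<exists>F. decomposes F (add_mset {u, y} (mset_set E0)) (mset_set (V - {x}))"
          using uyx uy fin fE xE by (auto intro!: contract_vertex simp: E0_def)
        moreover have "add_mset {u, y} (mset_set E0) = mset_set E"
          using fin uy'(1) by (simp add: E0_def mset_set.remove)
        ultimately show ?thesis by simp
      qed
    qed
  qed
qed

lemma family_edges_map: "family_edges (map (map f) F) = image_mset ((`) f) (family_edges F)"
  by (induction F) (auto simp: path_edges_map)

lemma family_ends_map:
  "\<forall>p\<in>set F. p \<noteq> [] \<Longrightarrow> family_ends (map (map f) F) = image_mset f (family_ends F)"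
  by (induction F) (auto simp: path_ends_def hd_map last_map)

lemma family_singletons:
  "family_edges (map (\<lambda>v. [v]) vs) = {#}" "family_ends (map (\<lambda>v. [v]) vs) = mset vs + mset vs"
  by (induction vs) (auto simp: path_ends_def)

text \<open>One vertex is added to the type, as the token of the lemma \<open>odd_graph_decomposition\<close>.\<close>

lemma odd_edges_decomposition:
  assumes sg: "simple_graph (Graph V E)"
    and odd: "\<And>e v. e \<in> E \<Longrightarrow> v \<in> e \<Longrightarrow> odd (degree E v)"
  shows "\<exists>F. decomposes F (mset_set E) (mset_set {v \<in> V. odd (degree E v)})"
proof -
  \<comment> \<open>No edge touches an even vertex, so restricting to \<open>W\<close> loses no
    edge, and the isolated \<open>None\<close> is the only even vertex.\<close>
  define W where "W = {v \<in> V. odd (degree E v)}"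
  define E' where "E' = (`) Some ` E"
  have inj: "inj_on ((`) Some) A" for A :: "'a set set"
    by (auto intro!: inj_onI simp: inj_image_eq_iff)
  have fin: "finite V" "finite W" "finite E"
    using sg simple_graph_finite_edges by (auto simp: simple_graph_def W_def)
  have deg: "degree E' (Some v) = degree E v" for v
  proof -
    have "{e \<in> E'. Some v \<in> e} = (`) Some ` {e \<in> E. v \<in> e}" by (auto simp: E'_def)
    then show ?thesis using inj by (simp add: degree_def card_image)
  qed
  have None: "None \<notin> e" if "e \<in> E'" for e using that by (auto simp: E'_def)
  then have "{e \<in> E'. None \<in> e} = {}" by blast
  then have deg_None: "degree E' None = 0" unfolding degree_def by (simp only: card.empty)
  have "simple_graph (Graph (insert None (Some ` W)) E')"
    using sg odd fin unfolding simple_graph_def W_def E'_def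
    by (auto simp: card_image) blast
  moreover have "even (degree E' v) \<longleftrightarrow> v = None" if "v \<in> insert None (Some ` W)" for v
    using that deg deg_None by (auto simp: W_def)
  ultimately obtain F where F:
    "decomposes F (mset_set E') (mset_set (insert None (Some ` W) - {None}))"
    using odd_graph_decomposition[of "insert None (Some ` W)" E' None] by auto
  have "insert None (Some ` W) - {None} = Some ` W" by auto
  with F have F: "\<forall>p\<in>set F. p \<noteq> [] \<and> distinct p" "family_edges F = mset_set E'"
    "family_ends F = mset_set (Some ` W)"
    by (simp_all add: decomposes_def)
  have "distinct (map the p)" if p: "p \<in> set F" for p
  proof -
    \<comment> \<open>\<open>None\<close> is on no edge and ends no path, so no path contains it and
      \<open>the\<close> is injective on each path.\<close>
    have "None \<notin> set p"
    proof
      assume "None \<in> set p"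
      then consider "p = [None]" | e where "e \<in># path_edges p" "None \<in> e"
        using path_edge_cases by metis
      then show False
      proof cases
        case 1
        then have "None \<in># family_ends F"
          using p by (force simp: in_family_ends path_ends_def)
        then show False using F(3) fin by auto
      next
        case 2
        then have "e \<in># family_edges F" using p by (auto simp: in_family_edges)
        then show False using F(2) fin 2 None by (auto simp: E'_def)
      qed
    qed
    then have "inj_on the (set p)" by (metis inj_onI option.expand)
    then show ?thesis using F(1) p by (simp add: distinct_map)
  qed
  moreover have "family_edges (map (map the) F) = mset_set E"
    using inj unfolding family_edges_map F(2) E'_def
    by (simp add: image_mset_mset_set[symmetric] multiset.map_comp comp_def image_image)
  moreover have "family_ends (map (map the) F) = mset_set W"
    using F(1,3) by (simp add: family_ends_map image_mset_mset_set[symmetric] multiset.map_comp comp_def)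
  ultimately have "decomposes (map (map the) F) (mset_set E) (mset_set W)"
    using F(1) by (auto simp: decomposes_def)
  then show ?thesis unfolding W_def by blast
qed

text \<open>Edges \<open>uv\<close> at an even vertex \<open>u\<close> are removed inductively. If
  \<open>v\<close> is even too, both become odd and the restored edge, as a path of its own, gives
  each its second end. If \<open>v\<close> is odd, it is even in the smaller graph, so it has two
  ends and passes one to \<open>u\<close>.\<close>

lemma end_decomposition:
  assumes "simple_graph (Graph V E)"
  shows "\<exists>F. decomposes F (mset_set E) (mset_set V + mset_set {v \<in> V. even (degree E v)})"
  using assms
proof (induction "card E" arbitrary: E rule: less_induct)
  case less
  have sg: "simple_graph (Graph V E)" and fin: "finite V" "finite E"
    using less.prems simple_graph_finite_edges by (auto simp: simple_graph_def)
  let ?W = "{v \<in> V. even (degree E v)}"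
  show ?case
  proof (cases "\<exists>u v. {u, v} \<in> E \<and> even (degree E u)")
    case True
    then obtain u v where uv: "{u, v} \<in> E" "even (degree E u)" by blast
    note uv' = simple_graph_edgeD[OF sg uv(1)]
    define E' where "E' = E - {{u, v}}"
    let ?W' = "{v \<in> V. even (degree E' v)}"
    have fW: "finite ?W'" using fin by simp
    have deg: "degree E w = degree E' w + of_bool (w = u \<or> w = v)" for w
      using degree_remove[OF fin(2) uv(1), of w] by (simp add: E'_def)
    have E: "E = insert {u, v} E'" "{u, v} \<notin> E'" "finite E'"
      using uv fin by (auto simp: E'_def)
    have "\<exists>F. decomposes F (mset_set E') (mset_set V + mset_set ?W')"
    proof (rule less.hyps)
      show "card E' < card E" using E by simp
      show "simple_graph (Graph V E')" unfolding E'_def by (rule simple_graph_remove[OF sg])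
    qed
    then obtain F where F: "decomposes F (mset_set E') (mset_set V + mset_set ?W')" by blast
    show ?thesis
    proof (cases "even (degree E v)")
      case True
      then have "?W = insert u (insert v ?W')" "u \<notin> ?W'" "v \<notin> ?W'"
        using uv' uv(2) deg by (auto split: if_splits)
      then have W: "mset_set ?W = add_mset u (add_mset v (mset_set ?W'))"
        using fW uv' by simp
      have "decomposes ([u, v] # F) (mset_set E) (mset_set V + mset_set ?W)"
        unfolding W using F E uv' by (simp add: decomposes_def path_ends_def)
      then show ?thesis by blast
    next
      case False
      then have W': "?W = insert u (?W' - {v})" "u \<notin> ?W' - {v}" "v \<in> ?W'"
        using uv' uv(2) deg by (auto split: if_splits)
      have "\<exists>F. decomposes F (mset_set (insert {v, u} E'))
          (add_mset u (mset_set V + mset_set ?W' - {#v#}))"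
      proof (rule shift_end[OF F])
        show "w \<in># mset_set V + mset_set ?W'" if "{w, u} \<in> E'" for w
          using that simple_graph_edgeD[OF sg, of w u] E(1) fin by auto
      qed (use E uv' fin in \<open>auto simp: insert_commute\<close>)
      moreover have "mset_set ?W = add_mset u (mset_set ?W' - {#v#})"
        using W' fW by (simp add: mset_set_Diff)
      then have "add_mset u (mset_set V + mset_set ?W' - {#v#}) = mset_set V + mset_set ?W"
        using W'(3) fW by simp
      moreover have "insert {v, u} E' = E" using E(1) by (simp add: insert_commute)
      ultimately show ?thesis by metis
    qed
  next
    case False
    have "odd (degree E v)" if e: "e \<in> E" "v \<in> e" for e v
    proof -
      obtain a b where "e = {a, b}" using simple_graph_edge[OF sg e(1)] by metis
      then show ?thesis using e False by (metis insert_commute insert_iff singletonD)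
    qed
    then obtain F where F: "decomposes F (mset_set E) (mset_set {v \<in> V. odd (degree E v)})"
      using odd_edges_decomposition[OF sg] by blast
    \<comment> \<open>Now even vertices are isolated, and a trivial path at each supplies exactly
      its two ends.\<close>
    obtain vs where "set vs = ?W" "distinct vs"
      using finite_distinct_list[of ?W] fin by auto
    then have vs: "mset vs = mset_set ?W" using mset_set_set by metis
    have "V = {v \<in> V. odd (degree E v)} \<union> ?W" by auto
    then have "mset_set V = mset_set {v \<in> V. odd (degree E v)} + mset_set ?W"
      using fin mset_set_Union[of "{v \<in> V. odd (degree E v)}" ?W] by auto
    then have "decomposes (F @ map (\<lambda>v. [v]) vs) (mset_set E) (mset_set V + mset_set ?W)"
      using F vs by (auto simp: decomposes_def family_singletons)
    then show ?thesis by blast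
  qed
qed

section \<open>Orienting the paths\<close>

definition reoriented :: "'a list list \<Rightarrow> 'a list list \<Rightarrow> bool" where
  "reoriented = list_all2 (\<lambda>p q. q = p \<or> q = rev p)"

lemma reoriented_invariants:
  assumes "reoriented F F'" "\<forall>p\<in>set F. p \<noteq> []"
  shows "family_edges F' = family_edges F" "family_ends F' = family_ends F"
    "\<forall>p\<in>set F'. p \<in> set F \<or> rev p \<in> set F"
  using assms unfolding reoriented_def by (induction rule: list_all2_induct) auto

lemma in_ends_hd_last: "hd p \<in># path_ends p" "last p \<in># path_ends p"
  by (simp_all add: path_ends_def)

text \<open>The paths are the edges of a multigraph of maximum degree 2 on the end vertices, to be
  oriented with in- and out-degrees at most 1. Two paths meeting at \<open>v\<close> are concatenated, and
  the orientation of the concatenation is inherited by both.\<close>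

lemma orientation_exists:
  assumes "\<forall>p\<in>set F. p \<noteq> []" "\<And>v. count (family_ends F) v \<le> 2"
  shows "\<exists>F'. reoriented F F' \<and> distinct (map hd F') \<and> distinct (map last F')"
  using assms
proof (induction "length F" arbitrary: F rule: less_induct)
  case less
  show ?case
  proof (cases F)
    case Nil
    then show ?thesis by (auto simp: reoriented_def)
  next
    case (Cons p F1)
    have p: "p \<noteq> []" using less.prems Cons by auto
    define v where "v = last p"
    show ?thesis
    proof (cases "v \<in># family_ends F1")
      case False
      have "\<exists>F'. reoriented F1 F' \<and> distinct (map hd F') \<and> distinct (map last F')"
      proof (rule less.hyps)
        show "count (family_ends F1) w \<le> 2" for w
          using less.prems(2)[of w] Cons by simp
      qed (use Cons less.prems in auto)
      then obtain F' where F': "reoriented F1 F'" "distinct (map hd F')" "distinct (map last F')"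
        by blast
      have ends: "family_ends F' = family_ends F1"
        using reoriented_invariants[OF F'(1)] less.prems Cons by auto
      then have v: "v \<notin> hd ` set F'" "v \<notin> last ` set F'"
        using False in_ends_hd_last by (metis imageE in_family_ends)+
      show ?thesis
      proof (cases "hd p \<in> hd ` set F'")
        case False
        then show ?thesis using F' v Cons
          by (intro exI[of _ "p # F'"]) (auto simp: reoriented_def v_def)
      next
        case True
        \<comment> \<open>Otherwise \<open>hd p\<close> would be an end twice among the other paths
          and once more in \<open>p\<close>. Hence \<open>p\<close> may be reversed.\<close>
        have "hd p \<notin> last ` set F'"
        proof
          assume "hd p \<in> last ` set F'"
          moreover have "family_ends F' = mset (map hd F') + mset (map last F')" for F' :: "'a list list"
            by (induction F') (auto simp: path_ends_def)
          ultimately have "count (family_ends F') (hd p) \<ge> 2"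
            using True F' by (simp add: distinct_count_atmost_1)
          then show False
            using ends less.prems(2)[of "hd p"] Cons by (simp add: path_ends_def split: if_splits)
        qed
        then show ?thesis using F' v Cons p
          by (intro exI[of _ "rev p # F'"])
            (auto simp: reoriented_def v_def hd_rev last_rev)
      qed
    next
      case True
      then obtain q where q: "q \<in> set F1" "v \<in># path_ends q" by (auto simp: in_family_ends)
      obtain A B where AB: "F1 = A @ q # B" using q(1) by (meson split_list)
      have qn: "q \<noteq> []" using less.prems Cons q by auto
      have "hd q = v \<or> hd (rev q) = v" using q(2) by (auto simp: path_ends_def hd_rev)
      then obtain q0 where q0: "q0 = q \<or> q0 = rev q" "hd q0 = v" by blast
      have q0n: "q0 \<noteq> []" "path_ends q0 = path_ends q" using q0 qn by auto
      have "family_ends F = path_ends p + path_ends q0 + family_ends (A @ B)"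
        using Cons AB q0n by simp
      then have ends_F: "family_ends F = {#v, v, hd p, last q0#} + family_ends (A @ B)"
        by (simp add: path_ends_def v_def q0)
      have "count (family_ends F) v \<le> 2" using less.prems(2) .
      \<comment> \<open>The two ends that meet at \<open>v\<close> exhaust its quota of 2.\<close>
      then have vn: "v \<notin># family_ends (A @ B)" "hd p \<noteq> v" "last q0 \<noteq> v"
        unfolding ends_F by (auto simp: not_in_iff split: if_splits)
      \<comment> \<open>The concatenation repeats \<open>v\<close>, so it is not a path; the
        induction speaks of nonempty lists, of which only the first and last entries matter.\<close>
      have "\<exists>F'. reoriented ((p @ q0) # A @ B) F' \<and> distinct (map hd F') \<and> distinct (map last F')"
      proof (rule less.hyps)
        fix w
        have "path_ends (p @ q0) = {#hd p, last q0#}"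
          using p q0n by (simp add: path_ends_def)
        then show "count (family_ends ((p @ q0) # A @ B)) w \<le> 2"
          using less.prems(2)[of w] unfolding ends_F by (simp split: if_splits)
      qed (use Cons AB less.prems p in auto)
      then obtain F' where F': "reoriented ((p @ q0) # A @ B) F'"
        "distinct (map hd F')" "distinct (map last F')" by blast
      then obtain r C1 C2 where "F' = r # C1 @ C2" "r = p @ q0 \<or> r = rev (p @ q0)"
        "reoriented A C1" "reoriented B C2"
        unfolding reoriented_def by (auto simp: list_all2_Cons1 list_all2_append1)
      with F' have C: "r = p @ q0 \<or> r = rev (p @ q0)" "reoriented A C1" "reoriented B C2"
        "distinct (map hd (r # C1 @ C2))" "distinct (map last (r # C1 @ C2))"
        by auto
      have "reoriented (A @ B) (C1 @ C2)"
        using C unfolding reoriented_def by (auto intro: list_all2_appendI)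
      then have "family_ends (C1 @ C2) = family_ends (A @ B)"
        using less.prems Cons AB by (intro reoriented_invariants(2)) auto
      \<comment> \<open>Cutting \<open>r\<close> again makes \<open>v\<close> once a last and once a
        first vertex, and no other path claims either place.\<close>
      then have v: "v \<notin> hd ` set (C1 @ C2)" "v \<notin> last ` set (C1 @ C2)"
        using vn(1) in_ends_hd_last by (metis imageE in_family_ends)+
      have r0: "rev q0 = q \<or> rev q0 = rev q" using q0 by auto
      show ?thesis
        using C(1)
      proof
        assume r: "r = p @ q0"
        have "hd r = hd p" "last r = last q0" using r p q0n by auto
        then show ?thesis using C(2-5) v vn q0 Cons AB
          by (intro exI[of _ "p # C1 @ q0 # C2"])
            (auto simp: reoriented_def v_def[symmetric] intro!: list_all2_appendI)
      next
        assume r: "r = rev (p @ q0)"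
        have "hd r = last q0" "last r = hd p" using r p q0n by (auto simp: hd_rev last_rev)
        moreover have "hd (rev p) = v" "last (rev p) = hd p" "hd (rev q0) = last q0" "last (rev q0) = v"
          using p q0n q0 by (auto simp: hd_rev last_rev v_def)
        ultimately show ?thesis using C(2-5) v vn r0 Cons AB
          by (intro exI[of _ "rev p # C1 @ rev q0 # C2"])
            (auto simp: reoriented_def intro!: list_all2_appendI)
      qed
    qed
  qed
qed

section \<open>Threads through the layers\<close>

text \<open>An edge shared by two different members would have multiplicity at least 2 in the sum.
  Equal members collapse in the set of paths, which only lowers the count.\<close>

lemma path_number_le:
  assumes F: "\<And>p. p \<in># F \<Longrightarrow> p \<noteq> [] \<and> distinct p \<and> set p \<subseteq> verts G"
    and edges: "(\<Sum>p\<in>#F. path_edges p) = mset_set (edges G)" and fin: "finite (edges G)"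
  shows "path_number G \<le> size F"
proof -
  let ?P = "path_on ` set_mset F"
  have edges_on: "edges (path_on p) = set_mset (path_edges p)" for p :: "'a list"
    by (simp add: path_on_def path_edges_conv_nth)
  have union: "(\<Union>Q\<in>?P. edges Q) = edges G"
  proof -
    have "(\<Union>Q\<in>?P. edges Q) = set_mset (\<Sum>p\<in>#F. path_edges p)"
      by (simp add: edges_on)
    then show ?thesis using edges fin by simp
  qed
  have "edges (path_on p) \<inter> edges (path_on q) = {}"
    if pq: "p \<in># F" "q \<in># F" "path_on p \<noteq> path_on q" for p q
  proof (rule ccontr)
    assume "edges (path_on p) \<inter> edges (path_on q) \<noteq> {}"
    then obtain e where e: "e \<in># path_edges p" "e \<in># path_edges q" by (auto simp: edges_on)
    have "p \<noteq> q" using pq by auto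
    then obtain F' where "F = add_mset p (add_mset q F')"
      using pq by (metis insert_noteq_member multi_member_split)
    then have "count (\<Sum>p\<in>#F. path_edges p) e \<ge> count (path_edges p) e + count (path_edges q) e"
      by simp
    moreover have "count (path_edges p) e > 0" "count (path_edges q) e > 0" using e by simp_all
    moreover have "count (mset_set (edges G)) e \<le> 1" by (simp add: count_mset_set')
    ultimately show False unfolding edges by linarith
  qed
  then have "disjoint_family_on edges ?P" by (auto simp: disjoint_family_on_def)
  moreover have "is_path Q \<and> subgraph Q G" if "Q \<in> ?P" for Q
    using that F union by (fastforce simp: is_path_def subgraph_def path_on_def)
  ultimately have "path_decomposition G ?P"
    using union by (simp add: path_decomposition_def)
  then have "path_number G \<le> card ?P"
    unfolding path_number_def by (intro Least_le) blast
  also have "\<dots> \<le> card (set_mset F)" by (simp add: card_image_le)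
  also have "\<dots> \<le> size F"
    by (induction F) (auto intro: order.trans[OF card_insert_le_m1])
  finally show ?thesis .
qed

lemma sum_image_mset: "finite S \<Longrightarrow> (\<Sum>p\<in>S. image_mset f (g p)) = image_mset f (\<Sum>p\<in>S. g p)"
  by (induction rule: finite_induct) auto

lemma sum_mset_set_disjoint:
  assumes "finite I" "\<And>i. i \<in> I \<Longrightarrow> finite (A i)"
    "\<And>i j. i \<in> I \<Longrightarrow> j \<in> I \<Longrightarrow> i \<noteq> j \<Longrightarrow> A i \<inter> A j = {}"
  shows "(\<Sum>i\<in>I. mset_set (A i)) = mset_set (\<Union>i\<in>I. A i)"
  using assms
proof (induction rule: finite_induct)
  case (insert i I)
  have "A i \<inter> (\<Union>j\<in>I. A j) = {}" using insert by fastforce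
  then show ?case using insert by (simp add: mset_set_Union)
qed simp

text \<open>A thread meets each layer in one contiguous piece, so it cannot intersect itself.\<close>

locale oriented_decomposition =
  fixes V :: "'a set" and E :: "'a set set" and S :: "'a list set"
  assumes sg: "simple_graph (Graph V E)"
    and finS: "finite S"
    and paths: "\<And>p. p \<in> S \<Longrightarrow> p \<noteq> [] \<and> distinct p \<and> set p \<subseteq> V"
    and edges_S: "(\<Sum>p\<in>S. path_edges p) = mset_set E"
    and inj_hd: "inj_on hd S" and inj_last: "inj_on last S"
    and covered: "hd ` S \<union> last ` S = V"
begin

text \<open>Meaningful only if some path of \<open>S\<close> ends at \<open>hd q\<close>; by
  \<open>inj_last\<close> that path is then unique.\<close>

definition pred :: "'a list \<Rightarrow> 'a list" where
  "pred q = the_inv_into S last (hd q)"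

text \<open>The thread whose piece in layer \<open>k\<close> is the whole copy of \<open>q\<close>.
  If no path ends at \<open>hd q\<close>, there is nothing to continue from below, and the thread
  begins with the bare vertical edge at \<open>hd q\<close>.\<close>

primrec thread :: "nat \<Rightarrow> 'a list \<Rightarrow> (nat \<times> 'a) list" where
  "thread 0 q = map (Pair 0) q"
| "thread (Suc k) q =
    (if hd q \<in> last ` S then thread k (pred q) else [(k, hd q)]) @ map (Pair (Suc k)) q"

text \<open>Paths whose last vertex starts no path: their threads climb one vertical edge and
  stop.\<close>

definition loose :: "'a list set" where
  "loose = {p \<in> S. last p \<notin> hd ` S}"

primrec finished :: "nat \<Rightarrow> (nat \<times> 'a) list multiset" where
  "finished 0 = {#}"
| "finished (Suc k) =
    finished k + image_mset (\<lambda>p. thread k p @ [(Suc k, last p)]) (mset_set loose)"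

definition threads :: "nat \<Rightarrow> (nat \<times> 'a) list multiset" where
  "threads k = image_mset (thread k) (mset_set S) + finished k"

lemma pred:
  assumes "hd q \<in> last ` S"
  shows "pred q \<in> S" "last (pred q) = hd q"
  using the_inv_into_into[OF inj_last assms, of S] f_the_inv_into_f[OF inj_last assms]
  by (auto simp: pred_def)

lemma thread_props:
  assumes "q \<in> S"
  shows "thread k q \<noteq> [] \<and> distinct (thread k q) \<and> set (thread k q) \<subseteq> {..k} \<times> V
    \<and> last (thread k q) = (k, last q)"
  using assms
proof (induction k arbitrary: q)
  case 0
  then show ?case using paths[of q] by (auto simp: distinct_map inj_on_def last_map)
next
  case (Suc k)
  let ?p = "if hd q \<in> last ` S then thread k (pred q) else [(k, hd q)]"
  have q: "q \<noteq> []" "distinct q" "set q \<subseteq> V" using paths Suc.prems by auto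
  have p: "distinct ?p" "set ?p \<subseteq> {..k} \<times> V"
    using Suc.IH pred(1) q by auto
  then have "set ?p \<inter> set (map (Pair (Suc k)) q) = {}" by fastforce
  then have "distinct (?p @ map (Pair (Suc k)) q)"
    using p q by (simp add: distinct_map inj_on_def del: if_split)
  moreover have "set (?p @ map (Pair (Suc k)) q) \<subseteq> {..Suc k} \<times> V"
    using p q by (auto split del: if_split)
  ultimately show ?case using q by (simp only: thread.simps) (auto simp: last_map)
qed

lemma finished_props:
  "p \<in># finished k \<Longrightarrow> p \<noteq> [] \<and> distinct p \<and> set p \<subseteq> {..k} \<times> V"
proof (induction k)
  case (Suc k)
  show ?case
  proof (cases "p \<in># finished k")
    case True
    then show ?thesis using Suc.IH by auto
  next
    case False
    then obtain q where q: "q \<in> S" "p = thread k q @ [(Suc k, last q)]"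
      using Suc.prems finS by (auto simp: loose_def)
    have "last q \<in> V" using q(1) covered by auto
    then show ?thesis using thread_props[OF q(1), of k] q(2) by fastforce
  qed
qed simp

text \<open>Assigns the vertical edge above each vertex to one thread: that of the path starting at
  the upper copy if there is one, otherwise that of the loose path ending at the lower copy.\<close>

lemma hd_last_partition: "V = hd ` S \<union> last ` loose" "hd ` S \<inter> last ` loose = {}"
proof -
  show "V = hd ` S \<union> last ` loose" using covered by (auto simp: loose_def)
  have "v \<notin> hd ` S" if "v \<in> last ` loose" for v using that unfolding loose_def by (elim imageE) simp
  then show "hd ` S \<inter> last ` loose = {}" by blast
qed

text \<open>Each layer is reached by one running thread per path of \<open>S\<close>, and each
  passage upwards finishes one thread per loose path, that is, per vertex at which no path
  starts.\<close>

lemma size_threads: "size (threads k) = card S + k * (card V - card S)"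
proof -
  have "card V = card (hd ` S) + card (last ` loose)"
    using finS hd_last_partition(2)
    by (subst hd_last_partition(1), subst card_Un_disjoint) (auto simp: loose_def)
  also have "\<dots> = card S + card loose"
    using inj_hd inj_last by (simp add: card_image loose_def inj_on_def)
  finally have loose: "card loose = card V - card S" by simp
  have "size (finished k) = k * card loose" by (induction k) auto
  then show ?thesis by (simp add: threads_def loose)
qed

section \<open>The edges covered by the threads\<close>

definition vertical :: "nat \<Rightarrow> 'a \<Rightarrow> (nat \<times> 'a) set" where
  "vertical k v = {(k, v), (Suc k, v)}"

lemma vertical_sum: "(\<Sum>q\<in>S. {#vertical k (hd q)#}) + (\<Sum>p\<in>loose. {#vertical k (last p)#})
    = image_mset (vertical k) (mset_set V)"
proof -
  have "(\<Sum>q\<in>S. {#vertical k (hd q)#}) = (\<Sum>v\<in>hd ` S. {#vertical k v#})"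
    using inj_hd by (simp add: sum.reindex)
  moreover have "inj_on last loose" using inj_last by (auto simp: loose_def inj_on_def)
  then have "(\<Sum>p\<in>loose. {#vertical k (last p)#}) = (\<Sum>v\<in>last ` loose. {#vertical k v#})"
    by (simp add: sum.reindex)
  moreover have "(\<Sum>v\<in>V. {#vertical k v#}) =
      (\<Sum>v\<in>hd ` S. {#vertical k v#}) + (\<Sum>v\<in>last ` loose. {#vertical k v#})"
    using finS hd_last_partition(2)
    by (subst hd_last_partition(1), subst sum.union_disjoint) (auto simp: loose_def)
  moreover have "finite V" using sg by (simp add: simple_graph_def)
  then have "(\<Sum>v\<in>V. {#vertical k v#}) = image_mset (vertical k) (mset_set V)"
    using sum_image_mset[of V "vertical k" "\<lambda>v. {#v#}"] by simp
  ultimately show ?thesis by simp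
qed

text \<open>\<open>pred\<close> maps the paths that continue a thread bijectively onto the paths
  that are not loose, so each thread of layer \<open>k\<close> is either continued once or finished.
  The new edges are one vertical edge per vertex and one copy of each path.\<close>

lemma thread_step:
  "(\<Sum>q\<in>S. path_edges (thread (Suc k) q)) + (\<Sum>p\<in>loose. path_edges (thread k p @ [(Suc k, last p)]))
   = (\<Sum>q\<in>S. path_edges (thread k q)) + image_mset (vertical k) (mset_set V)
     + (\<Sum>q\<in>S. path_edges (map (Pair (Suc k)) q))"
proof -
  \<comment> \<open>The part of a thread inherited from lower layers; a thread that begins with the
    single vertex \<open>(k, hd q)\<close> inherits no edge.\<close>
  define below where "below q = (if hd q \<in> last ` S then path_edges (thread k (pred q)) else {#})" for q
  have up: "path_edges (thread (Suc k) q) =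
      below q + {#vertical k (hd q)#} + path_edges (map (Pair (Suc k)) q)" if q: "q \<in> S" for q
    using paths[OF q] pred[of q] thread_props[of "pred q" k]
    by (auto simp: below_def vertical_def path_edges_append hd_map)
  have "(\<Sum>q\<in>S. below q) = (\<Sum>q\<in>{q \<in> S. hd q \<in> last ` S}. path_edges (thread k (pred q)))"
    unfolding below_def using finS by (simp add: sum.inter_filter)
  also have "\<dots> = (\<Sum>p\<in>{p \<in> S. last p \<in> hd ` S}. path_edges (thread k p))"
  proof (rule sum.reindex_bij_witness[where i = "\<lambda>p. the_inv_into S hd (last p)" and j = pred])
    fix p assume p: "p \<in> {p \<in> S. last p \<in> hd ` S}"
    define q where "q = the_inv_into S hd (last p)"
    have q: "q \<in> S" "hd q = last p"
      using the_inv_into_into[OF inj_hd, of "last p" S] f_the_inv_into_f[OF inj_hd, of "last p"] p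
      by (auto simp: q_def)
    show "pred (the_inv_into S hd (last p)) = p"
      using q p the_inv_into_f_f[OF inj_last, of p] by (simp add: pred_def flip: q_def)
    show "the_inv_into S hd (last p) \<in> {q \<in> S. hd q \<in> last ` S}"
      using q p by (simp flip: q_def)
  qed (auto simp: pred the_inv_into_f_f inj_hd)
  finally have below: "(\<Sum>q\<in>S. below q) = (\<Sum>p\<in>{p \<in> S. last p \<in> hd ` S}. path_edges (thread k p))" .
  define B where "B = {p \<in> S. last p \<in> hd ` S}"
  have B: "S = B \<union> loose" "B \<inter> loose = {}" "finite B" "finite loose"
    using finS by (auto simp: B_def loose_def)
  have "(\<Sum>q\<in>S. path_edges (thread k q)) =
      (\<Sum>q\<in>S. below q) + (\<Sum>p\<in>loose. path_edges (thread k p))"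
    unfolding below B_def[symmetric] by (subst B(1), rule sum.union_disjoint) (fact B)+
  moreover have "path_edges (thread k p @ [(Suc k, last p)]) =
      path_edges (thread k p) + {#vertical k (last p)#}" if "p \<in> loose" for p
    using that thread_props[of p k] by (simp add: loose_def path_edges_append vertical_def)
  then have "(\<Sum>p\<in>loose. path_edges (thread k p @ [(Suc k, last p)])) =
      (\<Sum>p\<in>loose. path_edges (thread k p)) + (\<Sum>p\<in>loose. {#vertical k (last p)#})"
    by (simp only: sum.distrib cong: sum.cong)
  moreover have "(\<Sum>q\<in>S. path_edges (thread (Suc k) q)) =
      (\<Sum>q\<in>S. below q) + (\<Sum>q\<in>S. {#vertical k (hd q)#})
        + (\<Sum>q\<in>S. path_edges (map (Pair (Suc k)) q))"
    by (simp only: up sum.distrib cong: sum.cong)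
  ultimately show ?thesis
    by (simp only: vertical_sum[of k, symmetric] ac_simps)
qed

lemma threads_edges:
  "(\<Sum>p\<in>#threads k. path_edges p) = (\<Sum>i\<le>k. \<Sum>q\<in>S. path_edges (map (Pair i) q))
     + (\<Sum>i<k. image_mset (vertical i) (mset_set V))"
proof (induction k)
  case 0
  then show ?case by (simp add: threads_def sum_unfold_sum_mset multiset.map_comp comp_def)
next
  case (Suc k)
  have "(\<Sum>p\<in>#threads k. path_edges p) =
      (\<Sum>q\<in>S. path_edges (thread k q)) + (\<Sum>p\<in>#finished k. path_edges p)" for k
    by (simp add: threads_def sum_unfold_sum_mset multiset.map_comp comp_def)
  moreover have "(\<Sum>p\<in>#finished (Suc k). path_edges p) = (\<Sum>p\<in>#finished k. path_edges p)
      + (\<Sum>p\<in>loose. path_edges (thread k p @ [(Suc k, last p)]))"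
    by (simp add: sum_unfold_sum_mset multiset.map_comp comp_def)
  ultimately show ?case
    using Suc thread_step[of k] by (simp add: ac_simps del: thread.simps finished.simps)
qed

lemma product_edges:
  "edges (path_graph (Suc k) \<box> Graph V E) =
    (\<Union>i\<le>k. (`) (Pair i) ` E) \<union> (\<Union>i<k. vertical i ` V)" (is "?L = ?R")
proof
  show "?L \<subseteq> ?R"
  proof
    fix e assume "e \<in> ?L"
    then obtain a u b v where e: "e = {(a, u), (b, v)}" "a \<in> {0..<Suc k}" "u \<in> V"
      and cases: "{a, b} \<in> {{i, Suc i} | i. Suc i < Suc k} \<and> u = v \<or> {u, v} \<in> E \<and> a = b"
      unfolding cartesian_product_def path_graph_def graph.sel by blast
    from cases show "e \<in> ?R"
    proof
      assume "{a, b} \<in> {{i, Suc i} | i. Suc i < Suc k} \<and> u = v"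
      then obtain i where i: "{a, b} = {i, Suc i}" "i < k" "u = v" by auto
      then have "e = vertical i u" using e by (auto simp: vertical_def doubleton_eq_iff)
      then show ?thesis using i e by blast
    next
      assume *: "{u, v} \<in> E \<and> a = b"
      then have "e = Pair a ` {u, v}" using e by auto
      moreover have "a \<le> k" using e by simp
      ultimately show ?thesis using * by blast
    qed
  qed
next
  show "?R \<subseteq> ?L"
  proof
    fix e assume "e \<in> ?R"
    then consider i f where "i \<le> k" "f \<in> E" "e = Pair i ` f" | i v where "i < k" "v \<in> V" "e = vertical i v"
      by blast
    then show "e \<in> ?L"
    proof cases
      case 1
      then obtain u v where "f = {u, v}" "u \<in> V" "v \<in> V"
        using simple_graph_edge[OF sg] by metis
      then have "e = {(i, u), (i, v)}" "{u, v} \<in> E" "i \<in> {0..<Suc k}" "u \<in> V" "v \<in> V"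
        using 1 by auto
      then show ?thesis unfolding cartesian_product_def path_graph_def graph.sel by blast
    next
      case 2
      then have "e = {(i, v), (Suc i, v)}" "i \<in> {0..<Suc k}" "Suc i \<in> {0..<Suc k}"
        "Suc i < Suc k" by (auto simp: vertical_def)
      then show ?thesis
        using 2(2) unfolding cartesian_product_def path_graph_def graph.sel by blast
    qed
  qed
qed

lemma threads_decompose:
  "(\<Sum>p\<in>#threads k. path_edges p) = mset_set (edges (path_graph (Suc k) \<box> Graph V E))"
proof -
  have fin: "finite V" "finite E"
    using sg simple_graph_finite_edges by (auto simp: simple_graph_def)
  \<comment> \<open>Copies of an edge in different layers differ because edges are nonempty.\<close>
  have ne: "f \<noteq> {}" if "f \<in> E" for f using that sg by (auto simp: simple_graph_def)
  have inj: "inj_on ((`) (Pair i)) E" for i :: nat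
    by (intro inj_onI) (auto simp: inj_image_eq_iff inj_on_def)
  have "(\<Sum>q\<in>S. path_edges (map (Pair i) q)) = mset_set ((`) (Pair i) ` E)" for i :: nat
    using sum_image_mset[OF finS, of "(`) (Pair i)" path_edges] inj[of i]
    by (simp add: path_edges_map edges_S image_mset_mset_set)
  then have "(\<Sum>i\<le>k. \<Sum>q\<in>S. path_edges (map (Pair i) q)) = (\<Sum>i\<le>k. mset_set ((`) (Pair i) ` E))"
    by simp
  also have "\<dots> = mset_set (\<Union>i\<le>k. (`) (Pair i) ` E)"
  proof (rule sum_mset_set_disjoint)
    show "(`) (Pair i) ` E \<inter> (`) (Pair j) ` E = {}" if "i \<noteq> j" for i j
      using that ne by fastforce
  qed (use fin in auto)
  finally have horizontal: "(\<Sum>i\<le>k. \<Sum>q\<in>S. path_edges (map (Pair i) q)) =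
      mset_set (\<Union>i\<le>k. (`) (Pair i) ` E)" .
  have "inj_on (vertical i) V" for i by (auto simp: inj_on_def vertical_def doubleton_eq_iff)
  then have "(\<Sum>i<k. image_mset (vertical i) (mset_set V)) = (\<Sum>i<k. mset_set (vertical i ` V))"
    by (simp add: image_mset_mset_set)
  also have "\<dots> = mset_set (\<Union>i<k. vertical i ` V)"
    by (rule sum_mset_set_disjoint) (use fin in \<open>auto simp: vertical_def doubleton_eq_iff\<close>)
  finally have "(\<Sum>i<k. image_mset (vertical i) (mset_set V)) = mset_set (\<Union>i<k. vertical i ` V)" .
  moreover have "Pair i ` f \<noteq> vertical j v" for i j f v
  proof
    assume "Pair i ` f = vertical j v"
    then have "(j, v) \<in> Pair i ` f" "(Suc j, v) \<in> Pair i ` f" by (auto simp: vertical_def)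
    then show False by auto
  qed
  then have "(\<Union>i\<le>k. (`) (Pair i) ` E) \<inter> (\<Union>i<k. vertical i ` V) = {}" by auto
  ultimately show ?thesis
    using fin unfolding threads_edges product_edges horizontal by (simp add: mset_set_Union)
qed

lemma path_number_product:
  assumes "k \<ge> 1"
  shows "2 * path_number (path_graph (Suc k) \<box> Graph V E) \<le> Suc k * card V"
proof -
  let ?G = "path_graph (Suc k) \<box> Graph V E"
  have fin: "finite V" "finite E"
    using sg simple_graph_finite_edges by (auto simp: simple_graph_def)
  have "path_number ?G \<le> size (threads k)"
  proof (rule path_number_le)
    show "p \<noteq> [] \<and> distinct p \<and> set p \<subseteq> verts ?G" if "p \<in># threads k" for p
    proof -
      have "verts ?G = {..k} \<times> V"
        by (auto simp: cartesian_product_def path_graph_def)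
      then show ?thesis
        using that finS thread_props[of _ k] finished_props[of p k] by (auto simp: threads_def)
    qed
    show "finite (edges ?G)" using fin by (simp add: product_edges)
  qed (rule threads_decompose)
  moreover have "card S \<le> card V" "card V \<le> 2 * card S"
  proof -
    have "card (hd ` S) \<le> card V" using fin covered by (intro card_mono) auto
    then show "card S \<le> card V" using inj_hd by (simp add: card_image)
    have "card V \<le> card (hd ` S) + card (last ` S)" unfolding covered[symmetric] by (rule card_Un_le)
    then show "card V \<le> 2 * card S" using inj_hd inj_last by (simp add: card_image)
  qed
  \<comment> \<open>With \<open>c = card S\<close>, \<open>card V = c + d\<close> and
    \<open>k = j + 1\<close> there are \<open>c + d + j * d\<close> threads. Since
    \<open>d \<le> c\<close>, twice this is at most \<open>(j + 2) * (c + d)\<close>.\<close>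
  moreover obtain j where j: "k = Suc j" using assms by (cases k) auto
  moreover obtain d where d: "card V = card S + d" using calculation(2) le_Suc_ex by blast
  ultimately have pn: "path_number ?G \<le> card S + d + j * d" and "d \<le> card S"
    by (simp_all add: size_threads)
  then have "j * d \<le> j * card S" by (intro mult_le_mono2)
  then have "2 * (card S + d + j * d) \<le> 2 * (card S + d) + j * card S + j * d"
    by (simp add: distrib_left mult_2 del: mult_le_cancel1 nat_mult_le_cancel_disj)
  with mult_le_mono2[OF pn, of 2]
  have "2 * path_number ?G \<le> 2 * (card S + d) + j * card S + j * d" by (rule order.trans)
  also have "\<dots> = Suc k * card V" by (simp add: d j algebra_simps)
  finally show ?thesis .
qed

end

section \<open>An oriented decomposition of the given graph and the resulting bound\<close>

theorem theorem3p1: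
  fixes H :: "'a graph" and G :: "(nat \<times> 'a) graph" and m n :: nat
  assumes "m \<ge> 2"
    and "simple_graph H" and "connected_graph H" and "order H = n"
    and "G = path_graph m \<box> H"
  shows "order G = m * n \<and> real (path_number G) \<le> real (order G) / 2"
proof -
  obtain V E where H: "H = Graph V E" by (cases H)
  have sg: "simple_graph (Graph V E)" using assms(2) H by simp
  have fin: "finite V" "finite E"
    using sg simple_graph_finite_edges by (auto simp: simple_graph_def)
  obtain k where k: "m = Suc k" "k \<ge> 1" using assms(1) by (cases m) auto
  let ?D = "mset_set V + mset_set {v \<in> V. even (degree E v)}"
  obtain F where F: "decomposes F (mset_set E) ?D"
    using end_decomposition[OF sg] by blast
  have "count ?D v \<le> 2" for v by (simp add: count_mset_set')
  then obtain F' where F': "reoriented F F'" "distinct (map hd F')" "distinct (map last F')"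
    using orientation_exists[of F] F by (auto simp: decomposes_def)
  have inv: "family_edges F' = mset_set E" "family_ends F' = ?D"
    "\<forall>p\<in>set F'. p \<in> set F \<or> rev p \<in> set F"
    using reoriented_invariants[OF F'(1)] F by (auto simp: decomposes_def)
  \<comment> \<open>Every vertex occurs at least once in \<open>?D\<close>, so every vertex is a
    first or a last vertex.\<close>
  have ends: "hd ` set F' \<union> last ` set F' = V"
  proof -
    have "set_mset (family_ends F') = hd ` set F' \<union> last ` set F'"
      by (induction F') (auto simp: path_ends_def)
    then show ?thesis using inv(2) fin by auto
  qed
  interpret oriented_decomposition V E "set F'"
  proof
    show "p \<noteq> [] \<and> distinct p \<and> set p \<subseteq> V" if p: "p \<in> set F'" for p
    proof (intro conjI subsetI)
      obtain q where "q \<in> set F" "p = q \<or> p = rev q"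
        using p inv(3) by (metis rev_rev_ident)
      then show "p \<noteq> []" "distinct p" using F by (auto simp: decomposes_def)
      fix v assume "v \<in> set p"
      then consider "p = [v]" | e where "e \<in># path_edges p" "v \<in> e"
        using path_edge_cases by metis
      then show "v \<in> V"
      proof cases
        case 1
        then show ?thesis using p ends by force
      next
        case 2
        then have "e \<in># family_edges F'" using p by (auto simp: in_family_edges)
        then show ?thesis using 2 inv(1) fin sg by (auto simp: simple_graph_def)
      qed
    qed
    \<comment> \<open>Distinct first vertices exclude repeated paths, so the list may be replaced by
      its set.\<close>
    have "distinct F'" using F'(2) by (simp add: distinct_map)
    then show "(\<Sum>p\<in>set F'. path_edges p) = mset_set E"
      using inv(1) by (simp add: family_edges_def sum.distinct_set_conv_list)
  qed (use sg F' ends in \<open>auto simp: distinct_map\<close>)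
  have order: "order G = m * n"
    using assms(4) unfolding assms(5) H
    by (simp add: order_def cartesian_product_def path_graph_def card_cartesian_product)
  have "2 * path_number G \<le> m * n"
    using path_number_product[OF k(2)] assms(4) unfolding assms(5) H k(1)
    by (simp add: order_def)
  then have "real (2 * path_number G) \<le> real (m * n)" by (rule of_nat_mono)
  then show ?thesis using order by simp
qed

end
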